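(* Let $\lambda\ge1$, $n\ge2$, $k\ge1$, $1\le s\le k$ be integers such that an $\mathrm{OA}(\lambda n^s,k,n,s)$ exists, and let $S\subset\mathbb{Z}^{n^k}$ be the set of frequency vectors of all $\mathrm{OA}(\lambda n^s,k,n,s)$. Let $$\Omega_1=\left\{d\in E[s+2,k]\ \middle|\ \lambda\binom{d-1}{d-s-1}\equiv 0 \pmod 2\right\},\qquad \Omega_1'=\begin{cases}\{k\}&\text{if $k$ is odd},\\ \emptyset&\text{otherwise},\end{cases}$$ $$\Omega_2=\left\{d\in\{s+1,\ldots,k\}\ \middle|\ \lambda\binom{d-1}{d-1-s}\equiv 0\pmod n\right\}.$$ Consider the equality constraints $$(\ast)\qquad J_\emptyset^{x}(i_1,\ldots,i_k)=\lambda n^s,\qquad J_u^{x}(i_1,\ldots,i_k)=0\ \text{ for all }u\subseteq[k]\text{ with }1\le|u|\le s\text{ and all }(i_1,\ldots,i_k)\in\{l_1,\ldots,l_n\}^k.$$ (a) If $n=2$ and $s$ is even, then there exist $T\subseteq\Omega_1$ and $T'\subseteq\Omega_1'$ such that the affine hull of $S$ is the set of all $x\in\mathbb{R}^{n^k}$ satisfying $(\ast)$ together with $$J_{u}^{x}(i_1,\ldots,i_k)=0\ \text{ for all }u\subseteq[k]\text{ with }|u|\in T\cup(T-1)\text{ and all }(i_1,\ldots,i_k),$$ and, if $|T'|=1$, $J_{[k]}^{x}(i_1,\ldots,i_k)=0$ for all $(i_1,\ldots,i_k)$, where $T-1=\{d-1\mid d\in T\}$. (b) If $n\ge3$ or $s$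 is odd, then there exists $T\subseteq\Omega_2$ such that the affine hull of $S$ is the set of all $x\in\mathbb{R}^{n^k}$ satisfying $(\ast)$ together with $$J_{u}^{x}(i_1,\ldots,i_k)=0\ \text{ for all }u\subseteq[k]\text{ with }|u|\in T\text{ and all }(i_1,\ldots,i_k).$$
   Context: $[k]=\{1,\ldots,k\}$; $E[a,b]$ is the set of even integers in $[a,b]$. Fix $n$ symbols $l_1,\ldots,l_n$. An orthogonal array $\mathrm{OA}(\lambda n^s,k,n,s)$ is a $\lambda n^s\times k$ array with entries in $\{l_1,\ldots,l_n\}$ such that in every choice of $s$ columns each of the $n^s$ symbol combinations appears as a row exactly $\lambda$ times. Its frequency vector $x\in\mathbb{Z}^{n^k}$, indexed by $\{l_1,\ldots,l_n\}^k$, counts how often each $(i_1,\ldots,i_k)$ appears as a row. For any real or complex vector $x$ indexed by $\{l_1,\ldots,l_n\}^k$ and $u\subseteq[k]$ define recursively $$x_u(i_1,\ldots,i_k)=n^{-k+|u|}\sum_{\{i_j\mid j\notin u\}}x(i_1,\ldots,i_k)-\sum_{v\subsetneq u}x_v(i_1,\ldots,i_k)$$ (the first sum is over all values in $\{l_1,\ldots,l_n\}$ of the indices $i_j$, $j\notin u$; in particular $x_\emptyset=n^{-k}\sum_{i_1,\ldots,i_k}x(i_1,\ldots,i_k)$), and $J_u^{x}(i_1,\ldots,i_k)=n^kx_u(i_1,\ldots,i_k)$ (the $J$-characteristics). *)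

theory Defs
  imports "HOL-Analysis.Analysis" "HOL-Number_Theory.Cong"
begin

text \<open>
  The symbols \<open>l\<^sub>1, \<dots>, l\<^sub>n\<close> are the elements of a finite type \<open>'l\<close> with \<open>n = CARD('l)\<close>,
  and the columns \<open>[k]\<close> are the elements of a finite type \<open>'k\<close> with \<open>k = CARD('k)\<close>.
  So a row is a value of type \<open>'l ^ 'k\<close>, a vector indexed by \<open>{l\<^sub>1, \<dots>, l\<^sub>n}\<^sup>k\<close>
  has type \<open>'a ^ ('l ^ 'k)\<close>, and an array is the list of its rows.
\<close>

text \<open>
  A combination of symbols on the columns \<open>C\<close> is given as the restriction of some \<open>c\<close>;
  the entries of \<open>c\<close> outside \<open>C\<close> are irrelevant.
\<close>

definition orthogonal_array :: "nat \<Rightarrow> nat \<Rightarrow> ('l::finite ^ 'k::finite) list \<Rightarrow> bool" where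
  "orthogonal_array lam s A \<longleftrightarrow>
     length A = lam * CARD('l) ^ s \<and>
     (\<forall>C :: 'k set. card C = s \<longrightarrow>
        (\<forall>c :: 'l ^ 'k. card {r. r < length A \<and> (\<forall>j\<in>C. (A ! r) $ j = c $ j)} = lam))"

definition frequency_vector :: "('l::finite ^ 'k::finite) list \<Rightarrow> real ^ ('l ^ 'k)" where
  "frequency_vector A = (\<chi> i. real (card {r. r < length A \<and> A ! r = i}))"

definition OA_frequency_vectors :: "nat \<Rightarrow> nat \<Rightarrow> (real ^ ('l::finite ^ 'k::finite)) set" where
  "OA_frequency_vectors lam s =
     {frequency_vector A | A :: ('l ^ 'k) list. orthogonal_array lam s A}"

text \<open>
  \<open>J_part x u i\<close> is \<open>x\<^sub>u(i)\<close>. Summing over the indices in columns outside \<open>u\<close> means summing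
  over all \<open>i'\<close> that agree with \<open>i\<close> on \<open>u\<close>.
\<close>

function J_part :: "'a::field_char_0 ^ ('l::finite ^ 'k::finite) \<Rightarrow> 'k set \<Rightarrow> 'l ^ 'k \<Rightarrow> 'a" where
  "J_part x u i =
     of_nat CARD('l) powi (- int CARD('k) + int (card u)) *
       (\<Sum>i' | \<forall>j\<in>u. i' $ j = i $ j. x $ i')
     - (\<Sum>v | v \<subset> u. J_part x v i)"
  by pat_completeness auto
termination
  by (relation "Wellfounded.measure (\<lambda>(x, u, i). card u)") (auto intro: psubset_card_mono)

text \<open>Unrestricted unfolding does not terminate: the equation applies again under the sum.\<close>

declare J_part.simps [simp del]

definition J_char :: "'a::field_char_0 ^ ('l::finite ^ 'k::finite) \<Rightarrow> 'k set \<Rightarrow> 'l ^ 'k \<Rightarrow> 'a" where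
  "J_char x u i = of_nat (CARD('l) ^ CARD('k)) * J_part x u i"

definition OA_equalities :: "nat \<Rightarrow> nat \<Rightarrow> real ^ ('l::finite ^ 'k::finite) \<Rightarrow> bool" where
  "OA_equalities lam s x \<longleftrightarrow>
     (\<forall>i. J_char x {} i = real (lam * CARD('l) ^ s)) \<and>
     (\<forall>u. 1 \<le> card u \<and> card u \<le> s \<longrightarrow> (\<forall>i. J_char x u i = 0))"

definition Omega1 :: "nat \<Rightarrow> nat \<Rightarrow> nat \<Rightarrow> nat set" where
  "Omega1 lam s k =
     {d \<in> {s + 2..k}. even d \<and> [lam * ((d - 1) choose (d - s - 1)) = 0] (mod 2)}"

definition Omega1' :: "nat \<Rightarrow> nat set" where
  "Omega1' k = (if odd k then {k} else {})"

definition Omega2 :: "nat \<Rightarrow> nat \<Rightarrow> nat \<Rightarrow> nat \<Rightarrow> nat set" where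
  "Omega2 lam n s k =
     {d \<in> {s + 1..k}. [lam * ((d - 1) choose (d - 1 - s)) = 0] (mod n)}"

end

theory Submission
  imports Defs
begin

text \<open>
  Write \<open>x = \<Sum>u. x\<^sub>u\<close>. The vectors \<open>x\<close> with \<open>x = x\<^sub>u\<close> form a subspace, and the subspaces for
  \<open>card u = d\<close> together span a space \<open>V\<^sub>d\<close>. Permuting columns, and permuting symbols in each column
  separately, maps orthogonal arrays to orthogonal arrays, and \<open>V\<^sub>d\<close> is irreducible under these
  symmetries. So the direction space of the affine hull is a sum of some of the \<open>V\<^sub>d\<close>, and the affine
  hull is cut out by the equality constraints and the vanishing of \<open>x\<^sub>u\<close> for all \<open>u\<close> of certain sizes:
  the sizes at which every orthogonal array has vanishing components.

  Irreducibility is used in an explicit form. Let \<open>e\<^sub>a\<close> be the unit vector of the row \<open>a\<close>, so that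
  \<open>(e\<^sub>a)\<^sub>u(i) = J_kernel u i a\<close>. If \<open>x\<^sub>u(a) \<noteq> 0\<close> for some frequency vector \<open>x\<close>, the map
  \<open>y \<mapsto> y\<^sub>u(a) \<cdot> (e\<^sub>a)\<^sub>u\<close> is a combination of symbol permutations with coefficients of sum zero
  (\<open>J_kernel_rank_one\<close>). Hence \<open>(e\<^sub>a)\<^sub>u\<close> is a direction of the affine hull; by symmetry so are
  all vectors that span \<open>V\<^sub>d\<close>. The description of the hull is \<open>affine_hull_OA_frequency_vectors\<close>.

  It remains to restrict the vanishing sizes \<open>d > s\<close>. By inclusion-exclusion \<open>n\<^sup>k x\<^sub>u(i)\<close> is an integer
  congruent to \<open>\<plusminus> lam * n\<^sup>s * ((d - 1) choose s)\<close> modulo \<open>n\<^sup>s\<^sup>+\<^sup>1\<close>, so it can vanish only if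
  \<open>n\<close> divides \<open>lam * ((d - 1) choose s)\<close> (\<open>J_part_eq_0_imp_dvd\<close>). This is \<open>Omega2\<close>.

  For \<open>n = 2\<close> and even \<open>s\<close> there are more symmetries. The foldover of an array has one more column
  and strength \<open>s + 1\<close>, and exchanging the new column with an old one induces a symmetry of the
  frequency vectors that exchanges components of odd size \<open>d - 1\<close> with components of even size \<open>d\<close>
  (\<open>J_kernel_foldover_swap\<close>). So the sizes \<open>d - 1\<close> and \<open>d\<close> vanish together, and only an odd \<open>k\<close> is left
  without a partner.
\<close>

section \<open>The components of a vector as a kernel operator\<close>

text \<open>
  The map \<open>x \<mapsto> x\<^sub>u\<close> is linear, and its matrix is a tensor product over the columns:
  \<open>I - E\<close> on the columns in \<open>u\<close> and \<open>E\<close> on the others, where \<open>E\<close> averages over the symbols.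
\<close>

definition J_kernel :: "'k set \<Rightarrow> 'l::finite ^ 'k::finite \<Rightarrow> 'l ^ 'k \<Rightarrow> real" where
  "J_kernel u i i' =
     (\<Prod>j\<in>UNIV. if j \<in> u then of_bool (i $ j = i' $ j) - 1 / CARD('l) else 1 / CARD('l))"

lemma J_kernel_split:
  fixes i i' :: "'l::finite ^ 'k::finite"
  shows "J_kernel u i i' =
    (\<Prod>j\<in>u. of_bool (i $ j = i' $ j) - 1 / CARD('l)) * (1 / CARD('l)) ^ card (- u)"
proof -
  have "J_kernel u i i' =
     (\<Prod>j\<in>u. of_bool (i $ j = i' $ j) - 1 / CARD('l)) * (\<Prod>j\<in>-u. 1 / CARD('l))"
    unfolding J_kernel_def by (subst prod.If_cases) auto
  then show ?thesis by simp
qed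

lemma prod_of_bool: "finite A \<Longrightarrow> (\<Prod>j\<in>A. of_bool (P j)) = (of_bool (\<forall>j\<in>A. P j) :: 'a::comm_semiring_1)"
  by (induction A rule: finite_induct) auto

text \<open>
  Expanding \<open>\<Prod>j\<in>u. ((I - E) + E) = I\<close> over the subsets of \<open>u\<close> gives exactly the recursion that
  defines the components \<open>x\<^sub>v\<close>.
\<close>

lemma sum_J_kernel_subsets:
  fixes i i' :: "'l::finite ^ 'k::finite"
  shows "(\<Sum>v\<in>Pow u. J_kernel v i i') =
    real CARD('l) ^ card u / real CARD('l) ^ CARD('k) * of_bool (\<forall>j\<in>u. i' $ j = i $ j)"
proof -
  let ?n = "real CARD('l)"
  let ?D = "\<lambda>j. of_bool (i $ j = i' $ j) - 1 / ?n"
  have "J_kernel v i i' = (1 / ?n) ^ card (- u) * (prod ?D v * (\<Prod>j\<in>u - v. 1 / ?n))"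
    if "v \<subseteq> u" for v
  proof -
    have "card (- v) = card (- u) + card (u - v)"
      using that by (subst card_Un_disjoint[symmetric]) (auto intro!: arg_cong[where f = card])
    then show ?thesis by (simp add: J_kernel_split power_add)
  qed
  then have "(\<Sum>v\<in>Pow u. J_kernel v i i') =
      (1 / ?n) ^ card (- u) * (\<Sum>v\<in>Pow u. prod ?D v * (\<Prod>j\<in>u - v. 1 / ?n))"
    by (simp add: sum_distrib_left)
  also have "(\<Sum>v\<in>Pow u. prod ?D v * (\<Prod>j\<in>u - v. 1 / ?n)) = (\<Prod>j\<in>u. ?D j + 1 / ?n)"
    by (rule prod_add[symmetric]) simp
  also have "\<dots> = of_bool (\<forall>j\<in>u. i' $ j = i $ j)"
    by (simp add: prod_of_bool eq_commute)
  also have "(1 / ?n) ^ card (- u) = ?n ^ card u / ?n ^ CARD('k)"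
  proof -
    have "card u + card (- u) = CARD('k)"
      by (subst card_Un_disjoint[symmetric]) auto
    then show ?thesis by (simp add: field_simps flip: power_add)
  qed
  finally show ?thesis .
qed

lemma J_part_eq_sum:
  fixes x :: "real ^ ('l::finite ^ 'k::finite)"
  shows "J_part x u i = (\<Sum>i'\<in>UNIV. J_kernel u i i' * x $ i')"
proof (induction "card u" arbitrary: u rule: less_induct)
  case less
  let ?n = "real CARD('l)"
  have psub: "J_part x v i = (\<Sum>i'\<in>UNIV. J_kernel v i i' * x $ i')" if "v \<subset> u" for v
    using less that by (simp add: psubset_card_mono)
  have pow: "{v. v \<subset> u} = Pow u - {u}" by auto
  have "?n powi (- int CARD('k) + int (card u)) = ?n powi (- int CARD('k)) * ?n powi int (card u)"
    by (rule power_int_add) simp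
  also have "\<dots> = ?n ^ card u / ?n ^ CARD('k)"
    by (simp add: power_int_minus divide_inverse mult.commute)
  finally have "J_part x u i = ?n ^ card u / ?n ^ CARD('k) *
        (\<Sum>i' | \<forall>j\<in>u. i' $ j = i $ j. x $ i')
      - (\<Sum>v | v \<subset> u. J_part x v i)"
    by (subst J_part.simps) (simp only:)
  also have "(\<Sum>i' | \<forall>j\<in>u. i' $ j = i $ j. x $ i') =
      (\<Sum>i'\<in>UNIV. of_bool (\<forall>j\<in>u. i' $ j = i $ j) * x $ i')"
    by (rule sum.mono_neutral_cong_left) auto
  also have "?n ^ card u / ?n ^ CARD('k) * \<dots> = (\<Sum>i'\<in>UNIV. (\<Sum>v\<in>Pow u. J_kernel v i i') * x $ i')"
    by (simp only: sum_J_kernel_subsets sum_distrib_left mult.assoc)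
  also have "\<dots> = (\<Sum>v\<in>Pow u. \<Sum>i'\<in>UNIV. J_kernel v i i' * x $ i')"
    by (simp add: sum_distrib_right sum.swap[of _ UNIV])
  also have "(\<Sum>v | v \<subset> u. J_part x v i) =
      (\<Sum>v\<in>Pow u - {u}. \<Sum>i'\<in>UNIV. J_kernel v i i' * x $ i')"
    unfolding pow[symmetric] by (rule sum.cong) (auto simp: psub)
  also have "(\<Sum>v\<in>Pow u. \<Sum>i'\<in>UNIV. J_kernel v i i' * x $ i') - \<dots> =
      (\<Sum>i'\<in>UNIV. J_kernel u i i' * x $ i')"
    by (subst sum.remove[of "Pow u" u]) simp_all
  finally show ?case .
qed

lemma sum_J_part_subsets:
  fixes x :: "real ^ ('l::finite ^ 'k::finite)"
  shows "(\<Sum>v\<in>Pow u. J_part x v i) =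
    real CARD('l) ^ card u / real CARD('l) ^ CARD('k) * (\<Sum>i' | \<forall>j\<in>u. i' $ j = i $ j. x $ i')"
proof -
  have "(\<Sum>v\<in>Pow u. J_part x v i) = (\<Sum>i'\<in>UNIV. (\<Sum>v\<in>Pow u. J_kernel v i i') * x $ i')"
    by (simp add: J_part_eq_sum sum_distrib_right sum.swap[of _ UNIV])
  also have "\<dots> = real CARD('l) ^ card u / real CARD('l) ^ CARD('k) *
      (\<Sum>i'\<in>UNIV. of_bool (\<forall>j\<in>u. i' $ j = i $ j) * x $ i')"
    by (simp only: sum_J_kernel_subsets sum_distrib_left mult.assoc)
  also have "(\<Sum>i'\<in>UNIV. of_bool (\<forall>j\<in>u. i' $ j = i $ j) * x $ i') =
      (\<Sum>i' | \<forall>j\<in>u. i' $ j = i $ j. x $ i')"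
    by (rule sum.mono_neutral_cong_right) auto
  finally show ?thesis .
qed

lemma sum_J_part:
  fixes x :: "real ^ ('l::finite ^ 'k::finite)"
  shows "(\<Sum>u\<in>UNIV. J_part x u i) = x $ i"
proof -
  have "{i'. \<forall>j\<in>(UNIV :: 'k set). i' $ j = i $ j} = {i}"
    by (auto simp: vec_eq_iff)
  then show ?thesis using sum_J_part_subsets[where u = UNIV and i = i and x = x] by simp
qed

lemma J_part_linear:
  fixes x y :: "real ^ ('l::finite ^ 'k::finite)"
  shows "J_part (a *\<^sub>R x + b *\<^sub>R y) u i = a * J_part x u i + b * J_part y u i"
  by (simp add: J_part_eq_sum algebra_simps sum.distrib sum_distrib_left)

lemma J_part_diff:
  fixes x y :: "real ^ ('l::finite ^ 'k::finite)"
  shows "J_part (x - y) u i = J_part x u i - J_part y u i"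
  using J_part_linear[of 1 x "-1" y] by simp

lemma J_char_eq_0_iff:
  fixes x :: "real ^ ('l::finite ^ 'k::finite)"
  shows "J_char x u i = 0 \<longleftrightarrow> J_part x u i = 0"
  by (simp add: J_char_def)

section \<open>Orthogonal arrays and the equality constraints\<close>

lemma sum_frequency_vector:
  "(\<Sum>i | P i. frequency_vector A $ i) = real (card {r. r < length A \<and> P (A ! r)})"
proof -
  have "{r. r < length A \<and> P (A ! r)} = (\<Union>i\<in>Collect P. {r. r < length A \<and> A ! r = i})"
    by auto
  also have "card \<dots> = (\<Sum>i\<in>Collect P. card {r. r < length A \<and> A ! r = i})"
    by (rule card_UN_disjoint) auto
  finally show ?thesis by (simp add: frequency_vector_def)
qed

text \<open>
  Only the entries of \<open>i\<close> in the columns \<open>v\<close> matter; taking a full row \<open>i\<close> avoids a separate type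
  of partial rows.
\<close>

definition agreeing_rows :: "('l::finite ^ 'k::finite) list \<Rightarrow> 'k set \<Rightarrow> 'l ^ 'k \<Rightarrow> nat" where
  "agreeing_rows A v i = card {r. r < length A \<and> (\<forall>j\<in>v. (A ! r) $ j = i $ j)}"

lemma sum_J_part_frequency_vector:
  fixes A :: "('l::finite ^ 'k::finite) list"
  shows "(\<Sum>w\<in>Pow v. J_part (frequency_vector A) w i) =
    real CARD('l) ^ card v / real CARD('l) ^ CARD('k) * agreeing_rows A v i"
  unfolding sum_J_part_subsets sum_frequency_vector agreeing_rows_def ..

lemma orthogonal_array_iff_agreeing_rows:
  "orthogonal_array lam s (A :: ('l::finite ^ 'k::finite) list) \<longleftrightarrow>
     length A = lam * CARD('l) ^ s \<and> (\<forall>v i. card v = s \<longrightarrow> agreeing_rows A v i = lam)"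
  unfolding orthogonal_array_def agreeing_rows_def by blast

lemma agreeing_rows_insert:
  fixes A :: "('l::finite ^ 'k::finite) list"
  assumes "j \<notin> v"
  shows "agreeing_rows A v i = (\<Sum>a\<in>UNIV. agreeing_rows A (insert j v) (\<chi> m. if m = j then a else i $ m))"
proof -
  have "{r. r < length A \<and> (\<forall>m\<in>v. (A ! r) $ m = i $ m)} =
      (\<Union>a\<in>UNIV. {r. r < length A \<and> (\<forall>m\<in>insert j v. (A ! r) $ m = (\<chi> m. if m = j then a else i $ m) $ m)})"
    using assms by auto
  then have "agreeing_rows A v i = card \<dots>" unfolding agreeing_rows_def by simp
  also have "\<dots> = (\<Sum>a\<in>UNIV. agreeing_rows A (insert j v) (\<chi> m. if m = j then a else i $ m))"
    unfolding agreeing_rows_def by (rule card_UN_disjoint) auto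
  finally show ?thesis .
qed

text \<open>
  Strength \<open>s\<close> implies every smaller strength: a further column splits the agreeing rows
  according to its \<open>n\<close> symbols, which turns the index \<open>lam\<close> into \<open>lam * n\<close>.
\<close>

lemma orthogonal_array_agreeing_rows:
  fixes A :: "('l::finite ^ 'k::finite) list"
  assumes "orthogonal_array lam s A" "s \<le> CARD('k)" "card v \<le> s"
  shows "agreeing_rows A v i = lam * CARD('l) ^ (s - card v)"
  using assms(3)
proof (induction "s - card v" arbitrary: v i)
  case 0
  then show ?case using assms(1) by (simp add: orthogonal_array_iff_agreeing_rows)
next
  case (Suc m)
  have "card v < CARD('k)" using Suc assms(2) by linarith
  then obtain j where j: "j \<notin> v" by (metis UNIV_eq_I nat_neq_iff)
  have "agreeing_rows A (insert j v) i' = lam * CARD('l) ^ m" for i'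
  proof -
    have "m = s - card (insert j v)" "card (insert j v) \<le> s"
      using Suc.hyps(2) Suc.prems j by simp_all
    then show ?thesis using Suc.hyps(1) by metis
  qed
  then show ?case
    unfolding agreeing_rows_insert[OF j] Suc.hyps(2)[symmetric] by simp
qed

text \<open>
  Summing \<open>x\<^sub>w\<close> over \<open>w \<subseteq> v\<close> recovers the number of rows with a given pattern on \<open>v\<close>, up to a
  factor. If the nonempty \<open>w\<close> of size at most \<open>s\<close> contribute nothing, that number does not depend on
  the pattern; conversely constant numbers force these components to vanish, by induction on the
  size.
\<close>

lemma orthogonal_array_iff_OA_equalities:
  fixes A :: "('l::finite ^ 'k::finite) list"
  assumes s: "s \<le> CARD('k)"
  shows "orthogonal_array lam s A \<longleftrightarrow> OA_equalities lam s (frequency_vector A)"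
proof
  let ?n = "real CARD('l)" and ?x = "frequency_vector A"
  assume A: "orthogonal_array lam s A"
  have n0: "?n \<noteq> 0" by simp
  have sub: "(\<Sum>w\<in>Pow v. J_part ?x w i) = lam * ?n ^ s / ?n ^ CARD('k)"
    if "card v \<le> s" for v i
    unfolding sum_J_part_frequency_vector orthogonal_array_agreeing_rows[OF A s that]
    using that by (simp flip: power_add)
  have e: "J_part ?x {} i = lam * ?n ^ s / ?n ^ CARD('k)" for i
    using sub[of "{}" i] by simp
  have "J_part ?x u i = 0" if "1 \<le> card u" "card u \<le> s" for u i
    using that
  proof (induction "card u" arbitrary: u rule: less_induct)
    case less
    have "u \<noteq> {}" using less.prems by auto
    have "(\<Sum>w\<in>Pow u - {u} - {{}}. J_part ?x w i) = 0"
    proof (rule sum.neutral, rule ballI)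
      fix w assume w: "w \<in> Pow u - {u} - {{}}"
      then have "card w < card u" "1 \<le> card w"
        by (auto simp: psubset_card_mono card_gt_0_iff Suc_le_eq psubset_eq)
      then show "J_part ?x w i = 0" using less by simp
    qed
    moreover have "(\<Sum>w\<in>Pow u. J_part ?x w i) =
        J_part ?x u i + (J_part ?x {} i + (\<Sum>w\<in>Pow u - {u} - {{}}. J_part ?x w i))"
      using \<open>u \<noteq> {}\<close> by (simp add: sum.remove[of _ u] sum.remove[of _ "{}"])
    ultimately show ?case using sub[of u i] e[of i] less.prems by simp
  qed
  then show "OA_equalities lam s ?x"
    using n0 by (auto simp: OA_equalities_def J_char_def e)
next
  let ?n = "real CARD('l)" and ?x = "frequency_vector A"
  assume "OA_equalities lam s ?x"
  then have e: "J_part ?x {} i = lam * ?n ^ s / ?n ^ CARD('k)"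
    and z: "1 \<le> card u \<Longrightarrow> card u \<le> s \<Longrightarrow> J_part ?x u i = 0" for u i
    by (auto simp: OA_equalities_def J_char_def field_simps)
  have sub: "?n ^ card v * agreeing_rows A v i = lam * ?n ^ s"
    if "card v \<le> s" for v i
  proof -
    have "(\<Sum>w\<in>Pow v - {{}}. J_part ?x w i) = 0"
    proof (rule sum.neutral, rule ballI)
      fix w assume w: "w \<in> Pow v - {{}}"
      then have "card w \<le> card v" "1 \<le> card w"
        by (auto simp: card_mono card_gt_0_iff Suc_le_eq)
      then show "J_part ?x w i = 0" using z that by simp
    qed
    then have "(\<Sum>w\<in>Pow v. J_part ?x w i) = lam * ?n ^ s / ?n ^ CARD('k)"
      by (simp add: sum.remove[of _ "{}"] e)
    then show ?thesis
      unfolding sum_J_part_frequency_vector by (simp add: field_simps)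
  qed
  have "real (agreeing_rows A {} undefined) = real (lam * CARD('l) ^ s)"
    using sub[of "{}" undefined] by simp
  then have "length A = lam * CARD('l) ^ s"
    unfolding agreeing_rows_def of_nat_eq_iff by simp
  moreover have "agreeing_rows A v i = lam" if "card v = s" for v i
    using sub[of v i] that by simp
  ultimately show "orthogonal_array lam s A"
    by (simp add: orthogonal_array_iff_agreeing_rows)
qed

text \<open>
  This is what makes symmetries cheap to verify: a bijection of the rows that permutes the components
  \<open>x\<^sub>u\<close> suitably preserves the right-hand side.
\<close>

lemma OA_frequency_vectors_iff:
  fixes x :: "real ^ ('l::finite ^ 'k::finite)"
  assumes s: "s \<le> CARD('k)"
  shows "x \<in> OA_frequency_vectors lam s \<longleftrightarrow>
    x \<in> range frequency_vector \<and> OA_equalities lam s x"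
  unfolding OA_frequency_vectors_def using orthogonal_array_iff_OA_equalities[OF s] by auto

section \<open>Rank-one maps as combinations of symbol permutations\<close>

text \<open>
  As a matrix, \<open>I - (p q)\<close> is the rank-one Laplacian \<open>(e\<^sub>p - e\<^sub>q) (e\<^sub>p - e\<^sub>q)\<^sup>T\<close> of the edge \<open>pq\<close>. So
  linear combinations of transpositions reduce to Laplacians of graphs on the symbols; only a star and
  the complete graph are needed.
\<close>

lemma of_bool_transpose:
  "(of_bool (Transposition.transpose p q b = b') :: real) =
     of_bool (b = b') - (of_bool (p = b) - of_bool (q = b)) * (of_bool (p = b') - of_bool (q = b'))"
  by (auto simp: Transposition.transpose_def)

lemma sum_star_laplacian:
  fixes p b b' :: "'l::finite"
  shows "(\<Sum>q\<in>UNIV. (of_bool (p = b) - of_bool (q = b)) * (of_bool (p = b') - of_bool (q = b')) :: real) =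
    real CARD('l) * (of_bool (p = b) * of_bool (p = b')) - of_bool (p = b) - of_bool (p = b') + of_bool (b = b')"
proof -
  have sum1: "(\<Sum>q\<in>UNIV. of_bool (q = c) :: real) = 1" for c :: 'l
    by simp
  have eq: "(of_bool (p = b) - of_bool (q = b)) * (of_bool (p = b') - of_bool (q = b')) =
      (of_bool (p = b) * of_bool (p = b') - of_bool (p = b) * of_bool (q = b')
        - of_bool (p = b') * of_bool (q = b) + of_bool (b = b') * of_bool (q = b) :: real)" for q
    by (cases "q = b"; cases "q = b'") auto
  show ?thesis
    unfolding eq sum.distrib sum_subtractf sum_distrib_left[symmetric] sum1 by simp
qed

lemma sum_complete_laplacian:
  fixes b b' :: "'l::finite"
  shows "(\<Sum>p\<in>UNIV. \<Sum>q\<in>UNIV. (of_bool (p = b) - of_bool (q = b)) * (of_bool (p = b') - of_bool (q = b')) :: real) =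
    2 * real CARD('l) * of_bool (b = b') - 2"
proof -
  have sum1: "(\<Sum>q\<in>UNIV. of_bool (q = c) :: real) = 1" for c :: 'l
    by simp
  have eq: "(of_bool (p = b) * of_bool (p = b') :: real) = of_bool (b = b') * of_bool (p = b)" for p
    by auto
  show ?thesis
    unfolding sum_star_laplacian eq sum.distrib sum_subtractf sum_distrib_left[symmetric] sum1
    by simp
qed

text \<open>
  The weight of \<open>(p, q)\<close> is the coefficient of the transposition \<open>(p q)\<close>; a pair \<open>(p, p)\<close> stands for the
  identity. The constant term weights the edges of the complete graph, \<open>\<gamma>\<close> those of the star at \<open>a\<close>, and
  \<open>\<beta>\<close>, placed at \<open>(a, a)\<close>, adjusts the coefficient of the identity.
\<close>

definition transposition_weight :: "'l::finite \<Rightarrow> real \<Rightarrow> real \<Rightarrow> 'l \<times> 'l \<Rightarrow> real" where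
  "transposition_weight a \<beta> \<gamma> z =
     1 / (2 * (real CARD('l))\<^sup>2) + \<beta> * of_bool (z = (a, a)) - \<gamma> * of_bool (fst z = a)"

lemma sum_transposition_weight:
  fixes a :: "'l::finite"
  shows "(\<Sum>z\<in>UNIV. transposition_weight a \<beta> \<gamma> z) = 1 / 2 + \<beta> - \<gamma> * real CARD('l)"
proof -
  have "(\<Sum>z\<in>UNIV. of_bool (z = (a, a)) :: real) = 1"
    by simp
  moreover have "(\<Sum>z\<in>(UNIV :: ('l \<times> 'l) set). of_bool (fst z = a) :: real) = real CARD('l)"
  proof -
    have "{z :: 'l \<times> 'l. fst z = a} = {a} \<times> UNIV" by auto
    then show ?thesis by (simp add: card_cartesian_product_singleton)
  qed
  ultimately show ?thesis
    unfolding transposition_weight_def sum.distrib sum_subtractf sum_distrib_left[symmetric]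
    by (simp add: power2_eq_square)
qed

lemma sum_weighted_transpositions:
  fixes a b b' :: "'l::finite"
  shows "(\<Sum>z\<in>UNIV. transposition_weight a \<beta> \<gamma> z * of_bool (Transposition.transpose (fst z) (snd z) b = b')) =
      (1 / 2 + \<beta> - \<gamma> * real CARD('l)) * of_bool (b = b')
      - (of_bool (b = b') / real CARD('l) - 1 / (real CARD('l))\<^sup>2)
      + \<gamma> * (real CARD('l) * (of_bool (a = b) * of_bool (a = b')) - of_bool (a = b) - of_bool (a = b') + of_bool (b = b'))"
proof -
  let ?D = "\<lambda>p q. (of_bool (p = b) - of_bool (q = b)) * (of_bool (p = b') - of_bool (q = b')) :: real"
  let ?w = "transposition_weight a \<beta> \<gamma>"
  have pairs: "(\<Sum>z\<in>UNIV. f z) = (\<Sum>p\<in>UNIV. \<Sum>q\<in>UNIV. f (p, q))" for f :: "'l \<times> 'l \<Rightarrow> real"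
    by (simp add: sum.cartesian_product flip: UNIV_Times_UNIV)
  have sum1: "(\<Sum>p\<in>UNIV. of_bool (p = a) :: real) = 1"
    by simp
  have "(\<Sum>z\<in>UNIV. ?w z * of_bool (Transposition.transpose (fst z) (snd z) b = b')) =
      (\<Sum>z\<in>UNIV. ?w z) * of_bool (b = b') - (\<Sum>z\<in>UNIV. ?w z * ?D (fst z) (snd z))"
    unfolding of_bool_transpose right_diff_distrib sum_subtractf sum_distrib_right ..
  also have "(\<Sum>z\<in>UNIV. ?w z * ?D (fst z) (snd z)) =
      (\<Sum>p\<in>UNIV. \<Sum>q\<in>UNIV. 1 / (2 * (real CARD('l))\<^sup>2) * ?D p q - \<gamma> * of_bool (p = a) * ?D a q)"
    unfolding pairs transposition_weight_def by (intro sum.cong refl) (auto simp: algebra_simps)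
  also have "\<dots> = 1 / (2 * (real CARD('l))\<^sup>2) * (\<Sum>p\<in>UNIV. \<Sum>q\<in>UNIV. ?D p q)
      - \<gamma> * ((\<Sum>p\<in>UNIV. of_bool (p = a)) * (\<Sum>q\<in>UNIV. ?D a q))"
    unfolding sum_product by (simp only: sum_subtractf sum_distrib_left mult.assoc)
  also have "\<dots> = (of_bool (b = b') / real CARD('l) - 1 / (real CARD('l))\<^sup>2)
      - \<gamma> * (real CARD('l) * (of_bool (a = b) * of_bool (a = b')) - of_bool (a = b) - of_bool (a = b') + of_bool (b = b'))"
    unfolding sum_complete_laplacian sum1
    unfolding sum_star_laplacian
    by (simp add: right_diff_distrib power2_eq_square)
  finally show ?thesis
    by (simp add: sum_transposition_weight)
qed

text \<open>
  With \<open>v\<close> the projection of \<open>e\<^sub>a\<close> to the vectors of sum zero, the rank-one matrix \<open>v v\<^sup>T\<close> is a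
  combination of permutation matrices. This is polarization: \<open>v\<close> is the average over \<open>p\<close> of
  \<open>e\<^sub>a - e\<^sub>p\<close>, and the products \<open>(e\<^sub>a - e\<^sub>p) (e\<^sub>a - e\<^sub>q)\<^sup>T + (e\<^sub>a - e\<^sub>q) (e\<^sub>a - e\<^sub>p)\<^sup>T\<close> are
  combinations of the Laplacians of the edges \<open>ap\<close>, \<open>aq\<close> and \<open>pq\<close>. The value \<open>\<beta> = 1/2\<close> makes
  the weights add up to zero, as they must since \<open>v v\<^sup>T\<close> kills the constants, which every
  permutation fixes.
\<close>

lemma column_projection_by_transpositions:
  fixes a b b' :: "'l::finite"
  shows "(\<Sum>z\<in>UNIV. transposition_weight a (1 / 2) (1 / real CARD('l)) z
        * of_bool (Transposition.transpose (fst z) (snd z) b = b')) =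
      (of_bool (b = a) - 1 / real CARD('l)) * (of_bool (a = b') - 1 / real CARD('l))"
proof -
  define n where "n = real CARD('l)"
  have "n \<noteq> 0" by (simp add: n_def)
  then show ?thesis
    unfolding sum_weighted_transpositions n_def[symmetric]
    by (cases "a = b"; cases "a = b'"; cases "b = b'") (auto simp: field_simps power2_eq_square)
qed

text \<open>
  On the other columns a multiple of the averaging matrix is needed, which is the identity minus a
  multiple of the Laplacian of the complete graph.
\<close>

lemma column_average_by_transpositions:
  fixes a b b' :: "'l::finite"
  shows "(\<Sum>z\<in>UNIV. transposition_weight a (1 / real CARD('l) - 1 / 2) 0 z
        * of_bool (Transposition.transpose (fst z) (snd z) b = b')) =
      1 / real CARD('l) * (1 / real CARD('l))"
  unfolding sum_weighted_transpositions by (simp add: power2_eq_square)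

text \<open>
  One transposition \<open>g j\<close> in each column \<open>j\<close>, given by the pair of symbols that it exchanges.
\<close>

definition transpose_symbols :: "('k \<Rightarrow> 'l \<times> 'l) \<Rightarrow> 'l::finite ^ 'k::finite \<Rightarrow> 'l ^ 'k" where
  "transpose_symbols g i = (\<chi> j. Transposition.transpose (fst (g j)) (snd (g j)) (i $ j))"

lemma bij_transpose_symbols: "bij (transpose_symbols g)"
  by (rule o_bij[of "transpose_symbols g"]) (auto simp: transpose_symbols_def vec_eq_iff fun_eq_iff)

lemma J_kernel_transpose_symbols:
  "J_kernel u (transpose_symbols g i) (transpose_symbols g i') = J_kernel u i i'"
  unfolding J_kernel_def transpose_symbols_def
  by (intro prod.cong refl) (simp add: inj_eq[OF bij_is_inj[OF bij_transpose]])

text \<open>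
  The map \<open>x \<mapsto> x\<^sub>u(a) \<cdot> (e\<^sub>a)\<^sub>u\<close> is a tensor product of the two column matrices above, so it lies in the
  span of the symbol permutations. One column in \<open>u\<close> suffices to make the coefficients add up to
  zero.
\<close>

lemma J_kernel_rank_one:
  fixes a :: "'l::finite ^ 'k::finite"
  assumes u: "u \<noteq> {}"
  obtains c :: "('k \<Rightarrow> 'l \<times> 'l) \<Rightarrow> real" where
    "(\<Sum>g\<in>UNIV. c g) = 0"
    "\<And>i i'. J_kernel u i a * J_kernel u a i' =
      (\<Sum>g\<in>UNIV. c g * of_bool (transpose_symbols g i = i'))"
proof -
  define c where "c j = (if j \<in> u then transposition_weight (a $ j) (1 / 2) (1 / real CARD('l))
      else transposition_weight (a $ j) (1 / real CARD('l) - 1 / 2) 0)" for j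
  have c0: "(\<Sum>z\<in>UNIV. c j z) = 0" if "j \<in> u" for j
    using that by (simp add: c_def sum_transposition_weight)
  have c: "(\<Sum>z\<in>UNIV. c j z * of_bool (Transposition.transpose (fst z) (snd z) b = b')) =
      (if j \<in> u then of_bool (b = a $ j) - 1 / real CARD('l) else 1 / real CARD('l)) *
      (if j \<in> u then of_bool (a $ j = b') - 1 / real CARD('l) else 1 / real CARD('l))" for j b b'
    unfolding c_def
    by (cases "j \<in> u") (simp_all only: column_projection_by_transpositions column_average_by_transpositions if_True if_False)
  \<comment> \<open>A product of sums over the columns chooses one transposition in each column.\<close>
  have choice: "(\<Prod>j\<in>UNIV. \<Sum>z\<in>UNIV. f j z) = (\<Sum>g\<in>UNIV. \<Prod>j\<in>UNIV. f j (g j))"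
    for f :: "'k \<Rightarrow> 'l \<times> 'l \<Rightarrow> real"
    using prod_sum_PiE[of UNIV "\<lambda>_. UNIV" f] by simp
  show ?thesis
  proof
    show "(\<Sum>g\<in>UNIV. \<Prod>j\<in>UNIV. c j (g j)) = 0"
      unfolding choice[symmetric] using u c0 by (auto intro!: prod_zero)
    show "J_kernel u i a * J_kernel u a i' =
      (\<Sum>g\<in>UNIV. (\<Prod>j\<in>UNIV. c j (g j)) * of_bool (transpose_symbols g i = i'))" for i i'
    proof -
      have "J_kernel u i a * J_kernel u a i' =
        (\<Prod>j\<in>UNIV. \<Sum>z\<in>UNIV. c j z * of_bool (Transposition.transpose (fst z) (snd z) (i $ j) = i' $ j))"
        unfolding J_kernel_def c prod.distrib ..
      also have "\<dots> = (\<Sum>g\<in>UNIV. (\<Prod>j\<in>UNIV. c j (g j)) * of_bool (transpose_symbols g i = i'))"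
        unfolding choice by (simp add: prod.distrib prod_of_bool transpose_symbols_def vec_eq_iff)
      finally show ?thesis .
    qed
  qed
qed

section \<open>Symmetries and the affine hull\<close>

lemma J_part_reindex:
  fixes x :: "real ^ ('l::finite ^ 'k::finite)" and g :: "'l ^ 'k \<Rightarrow> 'l ^ 'k"
  assumes "bij g" and "\<And>i i'. J_kernel w (g i) (g i') = J_kernel u i i'"
  shows "J_part (\<chi> i. x $ g i) u i = J_part x w (g i)"
proof -
  have "J_part (\<chi> i. x $ g i) u i = (\<Sum>i'\<in>UNIV. J_kernel w (g i) (g i') * x $ g i')"
    by (simp add: J_part_eq_sum assms(2))
  also have "\<dots> = (\<Sum>m\<in>UNIV. J_kernel w (g i) m * x $ m)"
    by (rule sum.reindex_bij_betw[OF assms(1)])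
  finally show ?thesis by (simp add: J_part_eq_sum)
qed

lemma frequency_vector_reindex:
  assumes "bij g"
  shows "(\<chi> i. frequency_vector A $ g i) = frequency_vector (map (inv g) A)"
proof -
  have "{r. r < length A \<and> A ! r = g i} = {r. r < length (map (inv g) A) \<and> map (inv g) A ! r = i}" for i
    using assms by (auto simp: bij_def inv_f_f surj_f_inv_f)
  then show ?thesis by (simp add: frequency_vector_def)
qed

text \<open>
  The hypothesis on the kernels says that the bijection \<open>g\<close> of the rows carries the component at \<open>u\<close>
  to the component at \<open>h u\<close>. Then \<open>x \<mapsto> x \<circ> g\<close> preserves the equality constraints as soon as \<open>h\<close>
  preserves the range of sizes that they mention.
\<close>

lemma OA_frequency_vectors_reindex:
  fixes x :: "real ^ ('l::finite ^ 'k::finite)" and g :: "'l ^ 'k \<Rightarrow> 'l ^ 'k"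
  assumes s: "s \<le> CARD('k)" and g: "bij g"
    and ker: "\<And>u i i'. J_kernel (h u) (g i) (g i') = J_kernel u i i'"
    and h: "h {} = {}" "\<And>u. 1 \<le> card u \<Longrightarrow> card u \<le> s \<Longrightarrow> 1 \<le> card (h u) \<and> card (h u) \<le> s"
    and x: "x \<in> OA_frequency_vectors lam s"
  shows "(\<chi> i. x $ g i) \<in> OA_frequency_vectors lam s"
proof -
  have "(\<chi> i. x $ g i) \<in> range frequency_vector"
    using x frequency_vector_reindex[OF g] by (auto simp: OA_frequency_vectors_iff[OF s])
  moreover have "OA_equalities lam s (\<chi> i. x $ g i)"
    using x h unfolding OA_frequency_vectors_iff[OF s] OA_equalities_def J_char_def
      J_part_reindex[OF g ker] by auto
  ultimately show ?thesis by (simp add: OA_frequency_vectors_iff[OF s])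
qed

lemma transpose_symbols_OA_frequency_vectors:
  fixes x :: "real ^ ('l::finite ^ 'k::finite)"
  assumes "s \<le> CARD('k)" "x \<in> OA_frequency_vectors lam s"
  shows "(\<chi> i. x $ transpose_symbols g i) \<in> OA_frequency_vectors lam s"
proof (rule OA_frequency_vectors_reindex[where h = "\<lambda>u. u" and g = "transpose_symbols g"])
  show "J_kernel u (transpose_symbols g i) (transpose_symbols g i') = J_kernel u i i'" for u and i i' :: "'l ^ 'k"
    by (rule J_kernel_transpose_symbols)
qed (simp_all add: assms bij_transpose_symbols)

text \<open>
  Applied to \<open>x\<close>, the rank-one map gives a combination of the vectors \<open>x \<circ> g\<close>, all of them frequency
  vectors, with coefficients of sum zero. Hence its value lies in the direction space of the affine
  hull, and this value is a nonzero multiple of \<open>(e\<^sub>a)\<^sub>u\<close>.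
\<close>

lemma J_kernel_column_in_span:
  fixes x :: "real ^ ('l::finite ^ 'k::finite)"
  assumes s: "s \<le> CARD('k)" and x: "x \<in> OA_frequency_vectors lam s" and x0: "x0 \<in> OA_frequency_vectors lam s"
    and u: "u \<noteq> {}" and nz: "J_part x u a \<noteq> 0"
  shows "(\<chi> i. J_kernel u i a) \<in> span ((\<lambda>y. y - x0) ` OA_frequency_vectors lam s)"
    (is "_ \<in> ?L")
proof -
  obtain c :: "('k \<Rightarrow> 'l \<times> 'l) \<Rightarrow> real" where c0: "(\<Sum>g\<in>UNIV. c g) = 0"
    and c: "\<And>i i'. J_kernel u i a * J_kernel u a i' =
      (\<Sum>g\<in>UNIV. c g * of_bool (transpose_symbols g i = i'))"
    by (rule J_kernel_rank_one[OF u, of a]) (rule that)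
  let ?x = "\<lambda>g. \<chi> i. x $ transpose_symbols g i"
  have "J_part x u a * J_kernel u i a = (\<Sum>g\<in>UNIV. c g * x $ transpose_symbols g i)" for i
  proof -
    have "J_part x u a * J_kernel u i a = (\<Sum>i'\<in>UNIV. (J_kernel u i a * J_kernel u a i') * x $ i')"
      unfolding J_part_eq_sum sum_distrib_right by (simp only: mult_ac)
    also have "\<dots> = (\<Sum>g\<in>UNIV. \<Sum>i'\<in>UNIV. c g * (of_bool (transpose_symbols g i = i') * x $ i'))"
      unfolding c sum_distrib_right mult.assoc by (rule sum.swap)
    also have "\<dots> = (\<Sum>g\<in>UNIV. c g * x $ transpose_symbols g i)"
    proof (rule sum.cong[OF refl])
      fix g
      have "(\<Sum>i'\<in>UNIV. of_bool (transpose_symbols g i = i') * x $ i') = x $ transpose_symbols g i"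
        by (subst sum.remove[of _ "transpose_symbols g i"]) (auto intro!: sum.neutral)
      then show "(\<Sum>i'\<in>UNIV. c g * (of_bool (transpose_symbols g i = i') * x $ i')) =
          c g * x $ transpose_symbols g i"
        by (simp only: sum_distrib_left[symmetric])
    qed
    finally show ?thesis .
  qed
  then have "J_part x u a *\<^sub>R (\<chi> i. J_kernel u i a) = (\<Sum>g\<in>UNIV. c g *\<^sub>R ?x g)"
    by (simp add: vec_eq_iff)
  also have "\<dots> = (\<Sum>g\<in>UNIV. c g *\<^sub>R (?x g - x0))"
    by (simp add: scaleR_diff_right sum_subtractf c0 flip: scaleR_sum_left)
  also have "\<dots> \<in> ?L"
    by (intro span_sum span_scale span_base) (use transpose_symbols_OA_frequency_vectors[OF s x] in blast)
  finally have "(1 / J_part x u a) *\<^sub>R (J_part x u a *\<^sub>R (\<chi> i. J_kernel u i a)) \<in> ?L"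
    by (rule span_scale)
  then show ?thesis using nz by simp
qed

lemma ex_bij_image_eq:
  fixes u u' :: "'k::finite set"
  assumes "card u = card u'"
  obtains \<sigma> where "bij \<sigma>" "\<sigma> -` u' = u"
proof -
  obtain f where f: "bij_betw f u u'"
    using finite_same_card_bij[OF _ _ assms] by auto
  have "card (- u) = card (- u')"
    using assms by (simp add: Compl_eq_Diff_UNIV card_Diff_subset)
  then obtain f' where f': "bij_betw f' (- u) (- u')"
    using finite_same_card_bij[of "- u" "- u'"] by auto
  define \<sigma> where "\<sigma> j = (if j \<in> u then f j else f' j)" for j
  have "bij_betw \<sigma> u u'" "bij_betw \<sigma> (- u) (- u')"
    using f f' bij_betw_cong[of u f \<sigma> u'] bij_betw_cong[of "- u" f' \<sigma> "- u'"]
    by (simp_all add: \<sigma>_def)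
  from bij_betw_combine[OF this] have "bij \<sigma>" by simp
  moreover have "\<sigma> -` u' = u"
    using \<open>bij_betw \<sigma> u u'\<close> \<open>bij_betw \<sigma> (- u) (- u')\<close> unfolding bij_betw_def by blast
  ultimately show ?thesis by (rule that)
qed

definition permute_columns :: "('k \<Rightarrow> 'k) \<Rightarrow> 'l ^ 'k::finite \<Rightarrow> 'l ^ 'k" where
  "permute_columns \<sigma> i = (\<chi> j. i $ \<sigma> j)"

lemma bij_permute_columns:
  fixes \<sigma> :: "'k::finite \<Rightarrow> 'k"
  assumes "bij \<sigma>"
  shows "bij (permute_columns \<sigma> :: 'l ^ 'k \<Rightarrow> 'l ^ 'k)"
proof (rule o_bij[of "permute_columns (inv \<sigma>)"])
  have "\<sigma> (inv \<sigma> j) = j" "inv \<sigma> (\<sigma> j) = j" for j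
    using assms by (simp_all add: bij_def surj_f_inv_f)
  then show "permute_columns (inv \<sigma>) \<circ> permute_columns \<sigma> = (id :: 'l ^ 'k \<Rightarrow> 'l ^ 'k)"
    "permute_columns \<sigma> \<circ> permute_columns (inv \<sigma>) = (id :: 'l ^ 'k \<Rightarrow> 'l ^ 'k)"
    by (simp_all add: permute_columns_def fun_eq_iff vec_eq_iff)
qed

lemma J_kernel_permute_columns:
  fixes i i' :: "'l::finite ^ 'k::finite"
  assumes "bij \<sigma>"
  shows "J_kernel (\<sigma> -` u) (permute_columns \<sigma> i) (permute_columns \<sigma> i') = J_kernel u i i'"
  unfolding J_kernel_def permute_columns_def
  by (rule trans[OF _ prod.reindex_bij_betw[OF assms]], rule prod.cong) simp_all

lemma permute_columns_OA_frequency_vectors: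
  fixes x :: "real ^ ('l::finite ^ 'k::finite)"
  assumes "s \<le> CARD('k)" "x \<in> OA_frequency_vectors lam s" and \<sigma>: "bij \<sigma>"
  shows "(\<chi> i. x $ permute_columns \<sigma> i) \<in> OA_frequency_vectors lam s"
proof (rule OA_frequency_vectors_reindex[where h = "\<lambda>u. \<sigma> -` u" and g = "permute_columns \<sigma>"])
  show "J_kernel (\<sigma> -` u) (permute_columns \<sigma> i) (permute_columns \<sigma> i') = J_kernel u i i'"
    for u and i i' :: "'l ^ 'k"
    by (rule J_kernel_permute_columns[OF \<sigma>])
  have "card (\<sigma> -` u) = card u" for u
    using \<sigma> by (simp add: card_vimage_inj bij_def)
  then show "1 \<le> card (\<sigma> -` u) \<and> card (\<sigma> -` u) \<le> s" if "1 \<le> card u" "card u \<le> s" for u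
    using that by simp
qed (simp_all add: assms bij_permute_columns)

text \<open>
  Row \<open>a'\<close> and columns \<open>u'\<close> are moved to \<open>a\<close> and \<open>u\<close> by permuting columns and then symbols, so a
  single nonzero value \<open>x\<^sub>u(a)\<close> puts the components at all \<open>u'\<close> of the same size of all basis vectors
  into the direction space.
\<close>

lemma J_kernel_column_in_span_of_card:
  fixes x :: "real ^ ('l::finite ^ 'k::finite)" and u u' :: "'k set" and a a' :: "'l ^ 'k"
  assumes s: "s \<le> CARD('k)" and x: "x \<in> OA_frequency_vectors lam s" and x0: "x0 \<in> OA_frequency_vectors lam s"
    and u: "u \<noteq> {}" and nz: "J_part x u a \<noteq> 0" and card: "card u' = card u"
  shows "(\<chi> i. J_kernel u' i a') \<in> span ((\<lambda>y. y - x0) ` OA_frequency_vectors lam s)"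
proof -
  obtain \<sigma> where \<sigma>: "bij \<sigma>" "\<sigma> -` u' = u"
    using ex_bij_image_eq[of u u'] card by metis
  let ?y = "\<chi> i. x $ permute_columns \<sigma> i"
  \<comment> \<open>In column \<open>j\<close> exchange the symbol required by \<open>x\<close> with the given symbol \<open>a' $ j\<close>.\<close>
  define g where "g j = (permute_columns (inv \<sigma>) a $ j, a' $ j)" for j
  let ?z = "\<chi> i. ?y $ transpose_symbols g i"
  have y: "?y \<in> OA_frequency_vectors lam s"
    by (rule permute_columns_OA_frequency_vectors[OF s x \<sigma>(1)])
  have z: "?z \<in> OA_frequency_vectors lam s"
    by (rule transpose_symbols_OA_frequency_vectors[OF s y])
  have "J_part ?z u' a' = J_part ?y u' (transpose_symbols g a')"
    by (rule J_part_reindex[OF bij_transpose_symbols J_kernel_transpose_symbols])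
  also have "transpose_symbols g a' = permute_columns (inv \<sigma>) a"
    by (simp add: transpose_symbols_def g_def vec_eq_iff)
  also have "J_part ?y u' \<dots> = J_part x u (permute_columns \<sigma> (permute_columns (inv \<sigma>) a))"
    unfolding \<sigma>(2)[symmetric]
    by (rule J_part_reindex[OF bij_permute_columns[OF \<sigma>(1)] J_kernel_permute_columns[OF \<sigma>(1)]])
  also have "permute_columns \<sigma> (permute_columns (inv \<sigma>) a) = a"
    using \<sigma>(1) by (simp add: permute_columns_def vec_eq_iff bij_def)
  finally have "J_part ?z u' a' \<noteq> 0" using nz by simp
  moreover have "u' \<noteq> {}" using card u by auto
  ultimately show ?thesis by (intro J_kernel_column_in_span[OF s z x0])
qed

definition vanishing_degrees :: "nat \<Rightarrow> (real ^ ('l::finite ^ 'k::finite)) set \<Rightarrow> nat set" where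
  "vanishing_degrees s S =
     {d \<in> {s + 1..CARD('k)}. \<forall>x\<in>S. \<forall>u. card u = d \<longrightarrow> (\<forall>i. J_part x u i = 0)}"

text \<open>
  The difference of \<open>x\<close> and a fixed frequency vector is the sum of its components at the sets \<open>u\<close>.
  If some frequency vector has a nonzero component at size \<open>card u\<close>, the component of the difference
  is a combination of vectors \<open>(e\<^sub>a)\<^sub>u\<close>, hence a direction of the affine hull. Otherwise the constraints
  force it to be zero.
\<close>

theorem affine_hull_OA_frequency_vectors:
  fixes S :: "(real ^ ('l::finite ^ 'k::finite)) set"
  assumes s: "s \<le> CARD('k)" and S: "S = OA_frequency_vectors lam s" and ne: "S \<noteq> {}"
  shows "affine hull S =
    {x. OA_equalities lam s x \<and> (\<forall>u. card u \<in> vanishing_degrees s S \<longrightarrow> (\<forall>i. J_char x u i = 0))}"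
    (is "_ = ?R")
proof
  show "affine hull S \<subseteq> ?R"
  proof (rule hull_minimal)
    show "S \<subseteq> ?R"
      using OA_frequency_vectors_iff[OF s] by (auto simp: S vanishing_degrees_def J_char_eq_0_iff)
    show "affine ?R"
    proof (unfold affine_def, intro ballI allI impI)
      fix x y :: "real ^ ('l ^ 'k)" and a b :: real
      assume x: "x \<in> ?R" and y: "y \<in> ?R" and ab: "a + b = 1"
      have lin: "J_char (a *\<^sub>R x + b *\<^sub>R y) u i = a * J_char x u i + b * J_char y u i" for u i
        by (simp add: J_char_def J_part_linear algebra_simps)
      have "a * c + b * c = c" for c using ab by (metis distrib_right mult_1)
      then show "a *\<^sub>R x + b *\<^sub>R y \<in> ?R"
        using x y by (simp add: OA_equalities_def lin)
    qed
  qed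
  show "?R \<subseteq> affine hull S"
  proof
    fix x assume x: "x \<in> ?R"
    obtain x0 where x0: "x0 \<in> S" using ne by blast
    let ?L = "span ((\<lambda>y. y - x0) ` S)"
    have R0: "x0 \<in> ?R"
      using OA_frequency_vectors_iff[OF s] x0 by (auto simp: S vanishing_degrees_def J_char_eq_0_iff)
    let ?d = "x - x0"
    have part: "(\<chi> i. J_part ?d u i) \<in> ?L" for u
    proof (cases "\<exists>y\<in>S. \<exists>u' a. u' \<noteq> {} \<and> card u = card u' \<and> J_part y u' a \<noteq> 0")
      case True
      then obtain y u' a where y: "y \<in> S" "u' \<noteq> {}" "card u = card u'" "J_part y u' a \<noteq> 0"
        by blast
      have "(\<chi> i. J_part ?d u i) = (\<Sum>a\<in>UNIV. ?d $ a *\<^sub>R (\<chi> i. J_kernel u i a))"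
        by (simp add: vec_eq_iff J_part_eq_sum mult.commute)
      also have "\<dots> \<in> ?L"
        unfolding S
        by (intro span_sum span_scale J_kernel_column_in_span_of_card[OF s])
           (use y x0 in \<open>auto simp: S\<close>)
      finally show ?thesis .
    next
      case False
      have "J_part ?d u i = 0" for i
      proof (cases "card u \<in> {s + 1..CARD('k)}")
        case True
        have "J_part y u' a = 0" if "y \<in> S" "card u' = card u" for y u' a
        proof -
          have "u' \<noteq> {}" using True that(2) by auto
          then show ?thesis using False that by metis
        qed
        then have "card u \<in> vanishing_degrees s S"
          using True by (simp add: vanishing_degrees_def)
        then show ?thesis using x R0 by (simp add: J_part_diff J_char_eq_0_iff)
      next
        case 2: False
        have "card u \<le> CARD('k)" by (rule card_mono) auto
        then have "card u \<le> s" using 2 by auto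
        have "J_char x u i = J_char x0 u i"
          using x R0 \<open>card u \<le> s\<close> by (cases "u = {}") (simp_all add: OA_equalities_def Suc_le_eq card_gt_0_iff)
        then show ?thesis by (simp add: J_part_diff J_char_def)
      qed
      then show ?thesis by (simp add: span_zero flip: zero_vec_def)
    qed
    have "?d = (\<Sum>u\<in>UNIV. \<chi> i. J_part ?d u i)"
      by (simp add: vec_eq_iff sum_J_part del: minus_vec_def vector_minus_component)
    also have "\<dots> \<in> ?L" by (intro span_sum part)
    finally have "x = x0 + ?d \<and> ?d \<in> ?L" by simp
    moreover have "affine hull S = (\<lambda>v. x0 + v) ` ?L"
      using affine_hull_span_gen[OF hull_inc[OF x0]] by simp
    ultimately show "x \<in> affine hull S" by blast
  qed
qed

section \<open>Divisibility at vanishing sizes\<close>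

lemma J_kernel_expand:
  fixes i i' :: "'l::finite ^ 'k::finite"
  shows "real CARD('l) ^ CARD('k) * J_kernel u i i' =
    (\<Sum>v\<in>Pow u. (- 1) ^ card (u - v) * real CARD('l) ^ card v * of_bool (\<forall>j\<in>v. i' $ j = i $ j))"
proof -
  let ?n = "real CARD('l)"
  have pow: "?n ^ CARD('k) * ((- 1 / ?n) ^ card (u - v) * (1 / ?n) ^ card (- u)) =
      (- 1) ^ card (u - v) * ?n ^ card v" if "v \<subseteq> u" for v
  proof -
    have "card v + card (u - v) = card u"
      using that by (subst card_Un_disjoint[symmetric]) (auto intro!: arg_cong[where f = card])
    moreover have "card u + card (- u) = CARD('k)"
      by (subst card_Un_disjoint[symmetric]) auto
    ultimately have "CARD('k) = card v + (card (u - v) + card (- u))"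
      by simp
    then have "?n ^ CARD('k) = ?n ^ card v * (?n ^ card (u - v) * ?n ^ card (- u))"
      by (simp only: power_add)
    then show ?thesis unfolding power_divide by simp
  qed
  have "J_kernel u i i' =
      (\<Prod>j\<in>u. of_bool (i $ j = i' $ j) + - 1 / ?n) * (1 / ?n) ^ card (- u)"
    by (simp add: J_kernel_split)
  also have "(\<Prod>j\<in>u. of_bool (i $ j = i' $ j) + - 1 / ?n) =
      (\<Sum>v\<in>Pow u. of_bool (\<forall>j\<in>v. i' $ j = i $ j) * (- 1 / ?n) ^ card (u - v))"
    by (simp only: prod_add[OF finite] prod_of_bool[OF finite] prod_constant eq_commute[of "i $ _"])
  finally have "?n ^ CARD('k) * J_kernel u i i' =
      (\<Sum>v\<in>Pow u. (?n ^ CARD('k) * ((- 1 / ?n) ^ card (u - v) * (1 / ?n) ^ card (- u)))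
         * of_bool (\<forall>j\<in>v. i' $ j = i $ j))"
    by (simp only: sum_distrib_left sum_distrib_right mult_ac)
  also have "\<dots> = (\<Sum>v\<in>Pow u. (- 1) ^ card (u - v) * ?n ^ card v * of_bool (\<forall>j\<in>v. i' $ j = i $ j))"
    by (rule sum.cong[OF refl]) (simp only: pow Pow_iff)
  finally show ?thesis .
qed

text \<open>
  Inclusion-exclusion: expanding \<open>\<Prod>j\<in>u. (n I - n E)\<close> over the subsets of \<open>u\<close> shows that
  \<open>n\<^sup>k x\<^sub>u\<close> is an integer.
\<close>

lemma J_part_frequency_vector_expand:
  fixes A :: "('l::finite ^ 'k::finite) list"
  shows "real CARD('l) ^ CARD('k) * J_part (frequency_vector A) u i =
    of_int (\<Sum>v\<in>Pow u. (- 1) ^ card (u - v) * int (CARD('l) ^ card v * agreeing_rows A v i))"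
proof -
  let ?n = "real CARD('l)" and ?x = "frequency_vector A"
  let ?e = "\<lambda>v i'. of_bool (\<forall>j\<in>v. i' $ j = i $ j) :: real"
  have agree: "(\<Sum>i'\<in>UNIV. ?e v i' * ?x $ i') = agreeing_rows A v i" for v
  proof -
    have "(\<Sum>i'\<in>UNIV. ?e v i' * ?x $ i') = (\<Sum>i' | \<forall>j\<in>v. i' $ j = i $ j. ?x $ i')"
      by (rule sum.mono_neutral_cong_right) auto
    then show ?thesis by (simp add: sum_frequency_vector agreeing_rows_def)
  qed
  have "?n ^ CARD('k) * J_part ?x u i = (\<Sum>i'\<in>UNIV. (?n ^ CARD('k) * J_kernel u i i') * ?x $ i')"
    by (simp add: J_part_eq_sum sum_distrib_left mult_ac)
  also have "\<dots> = (\<Sum>v\<in>Pow u. \<Sum>i'\<in>UNIV. (- 1) ^ card (u - v) * ?n ^ card v * (?e v i' * ?x $ i'))"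
    unfolding J_kernel_expand sum_distrib_right mult.assoc by (rule sum.swap)
  also have "\<dots> = (\<Sum>v\<in>Pow u. (- 1) ^ card (u - v) * ?n ^ card v * agreeing_rows A v i)"
    by (simp only: sum_distrib_left[symmetric] agree)
  finally show ?thesis by (simp add: mult.assoc)
qed

lemma alternating_sum_choose:
  "(\<Sum>j\<le>s. (- 1) ^ j * int (Suc m choose j)) = (- 1) ^ s * int (m choose s)"
  by (induction s) (simp_all add: algebra_simps)

lemma alternating_sum_small_subsets:
  assumes "finite u" "card u = Suc m"
  shows "(\<Sum>v | v \<subseteq> u \<and> card v \<le> s. (- 1) ^ card v) = (- 1) ^ s * int (m choose s)"
proof -
  have "(\<Sum>v | v \<subseteq> u \<and> card v \<le> s. (- 1) ^ card v :: int) =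
      (\<Sum>j\<le>s. \<Sum>v | v \<in> {v. v \<subseteq> u \<and> card v \<le> s} \<and> card v = j. (- 1) ^ card v)"
    by (rule sum.group[symmetric]) (use assms in auto)
  also have "\<dots> = (\<Sum>j\<le>s. \<Sum>v | v \<subseteq> u \<and> card v = j. (- 1) ^ j)"
    by (intro sum.cong refl) auto
  also have "\<dots> = (\<Sum>j\<le>s. (- 1) ^ j * int (Suc m choose j))"
    by (simp add: n_subsets assms mult.commute)
  finally show ?thesis by (simp add: alternating_sum_choose)
qed

text \<open>
  Modulo \<open>n\<^sup>s\<^sup>+\<^sup>1\<close> only the subsets of size at most \<open>s\<close> survive in the integer \<open>n\<^sup>k x\<^sub>u(i)\<close>. For
  these, the strength makes \<open>n ^ card v\<close> times the number of agreeing rows equal to \<open>lam * n\<^sup>s\<close>, so what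
  remains is \<open>lam * n\<^sup>s\<close> times a truncated
  alternating sum of binomial coefficients.
\<close>

lemma J_part_eq_0_imp_dvd:
  fixes A :: "('l::finite ^ 'k::finite) list"
  assumes s: "s \<le> CARD('k)" and A: "orthogonal_array lam s A"
    and u: "card u > s" and zero: "J_part (frequency_vector A) u i = 0"
  shows "CARD('l) dvd lam * ((card u - 1) choose (card u - 1 - s))"
proof -
  let ?n = "CARD('l)"
  obtain m where m: "card u = Suc m" using u by (cases "card u") auto
  let ?t = "\<lambda>v. (- 1) ^ card (u - v) * int (?n ^ card v * agreeing_rows A v i)"
  let ?small = "{v. v \<subseteq> u \<and> card v \<le> s}" and ?big = "{v. v \<subseteq> u \<and> card v > s}"
  have "of_int (\<Sum>v\<in>Pow u. ?t v) = (0 :: real)"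
    unfolding J_part_frequency_vector_expand[symmetric] zero by simp
  then have "(\<Sum>v\<in>Pow u. ?t v) = 0"
    by (simp only: of_int_eq_0_iff)
  moreover have "Pow u = ?small \<union> ?big" by auto
  moreover have "sum ?t (?small \<union> ?big) = sum ?t ?small + sum ?t ?big"
    by (rule sum.union_disjoint) auto
  ultimately have small: "sum ?t ?small = - sum ?t ?big"
    by (simp only: eq_neg_iff_add_eq_0)
  have "int ?n ^ Suc s dvd sum ?t ?big"
  proof (rule dvd_sum)
    fix v assume "v \<in> ?big"
    then have "int ?n ^ Suc s dvd int ?n ^ card v" by (intro le_imp_power_dvd) auto
    then show "int ?n ^ Suc s dvd ?t v" by (simp add: dvd_mult dvd_mult2)
  qed
  then have "int ?n ^ Suc s dvd sum ?t ?small"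
    by (simp only: small dvd_minus_iff)
  also have "sum ?t ?small = (\<Sum>v\<in>?small. (- 1) ^ card u * int lam * int ?n ^ s * (- 1) ^ card v)"
  proof (rule sum.cong[OF refl])
    fix v assume v: "v \<in> ?small"
    have "?n ^ card v * agreeing_rows A v i = lam * ?n ^ s"
      using orthogonal_array_agreeing_rows[OF A s, of v i] v by (simp add: mult_ac flip: power_add)
    moreover have "card u = card (u - v) + card v"
      using v by (simp add: card_Diff_subset finite_subset card_mono)
    then have "(- 1 :: int) ^ card u * (- 1) ^ card v = (- 1) ^ card (u - v)"
      by (simp add: power_add mult.assoc flip: power_mult_distrib)
    ultimately show "?t v = (- 1) ^ card u * int lam * int ?n ^ s * (- 1) ^ card v"
      by (simp add: mult_ac)
  qed
  also have "\<dots> = (- 1) ^ card u * int lam * int ?n ^ s * ((- 1) ^ s * int (m choose s))"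
    by (simp only: alternating_sum_small_subsets[OF finite m] flip: sum_distrib_left)
  also have "\<dots> = (- 1) ^ (card u + s) * (int ?n ^ s * int (lam * (m choose s)))"
    by (simp add: power_add mult_ac)
  finally have "int ?n ^ Suc s dvd int ?n ^ s * int (lam * (m choose s))"
    by (cases "even (card u + s)") simp_all
  then have "int ?n dvd int (lam * (m choose s))"
    by (simp add: mult.commute[of "int ?n"])
  then have "?n dvd lam * (m choose s)"
    by (simp only: int_dvd_int_iff)
  moreover have "m choose s = m choose (m - s)"
    using u m by (intro binomial_symmetric) simp
  ultimately show ?thesis using m by simp
qed

lemma vanishing_degrees_dvd:
  fixes S :: "(real ^ ('l::finite ^ 'k::finite)) set"
  assumes s: "s \<le> CARD('k)" and S: "S = OA_frequency_vectors lam s" and ne: "S \<noteq> {}"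
    and d: "d \<in> vanishing_degrees s S"
  shows "CARD('l) dvd lam * ((d - 1) choose (d - 1 - s))"
proof -
  obtain A :: "('l ^ 'k) list" where A: "orthogonal_array lam s A" "frequency_vector A \<in> S"
    using ne by (auto simp: S OA_frequency_vectors_def)
  have "d \<le> card (UNIV :: 'k set)" using d by (simp add: vanishing_degrees_def)
  then obtain u :: "'k set" where u: "card u = d"
    by (metis obtain_subset_with_card_n)
  have "J_part (frequency_vector A) u undefined = 0" "card u > s"
    using d A(2) u by (auto simp: vanishing_degrees_def)
  then show ?thesis using J_part_eq_0_imp_dvd[OF s A(1)] u by blast
qed

section \<open>The additional symmetry for two symbols\<close>

text \<open>
  The nontrivial character of a two-element set of symbols, of which \<open>z\<close> is the neutral one.
\<close>

definition symbol_sign :: "'l \<Rightarrow> 'l \<Rightarrow> real" where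
  "symbol_sign z b = (if b = z then 1 else - 1)"

text \<open>
  The rows that do not have \<open>z\<close> in column \<open>m\<close> are complemented outside column \<open>m\<close>. This map
  arises from the foldover of an array: append a constant column of symbols \<open>z\<close>, add the complements
  of all rows, exchange column \<open>m\<close> with the new column, and keep the rows with \<open>z\<close> in the new
  column.
\<close>

definition foldover_swap :: "'l \<Rightarrow> 'l \<Rightarrow> 'k \<Rightarrow> 'l ^ 'k::finite \<Rightarrow> 'l ^ 'k" where
  "foldover_swap z z' m i =
     (\<chi> j. if j \<noteq> m \<and> i $ m \<noteq> z then Transposition.transpose z z' (i $ j) else i $ j)"

text \<open>
  The action of the exchange on components. In the foldover the components sit at even sets of columns,
  the odd sets being completed by the new column; exchanging it with \<open>m\<close> fixes the sets that contain
  both or neither, and otherwise adds or removes \<open>m\<close>.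
\<close>

definition toggle_odd :: "'k \<Rightarrow> 'k set \<Rightarrow> 'k set" where
  "toggle_odd m u =
     (if even (card (u - {m})) then u else if m \<in> u then u - {m} else insert m u)"

text \<open>
  For two symbols \<open>I - E\<close> has rank one, so each component is given by a single character.
\<close>

lemma J_kernel_two_symbols:
  fixes i i' :: "'l::finite ^ 'k::finite"
  assumes two: "UNIV = {z, z' :: 'l}" "z \<noteq> z'"
  shows "J_kernel u i i' =
    (1 / 2) ^ CARD('k) * (\<Prod>j\<in>u. symbol_sign z (i $ j)) * (\<Prod>j\<in>u. symbol_sign z (i' $ j))"
proof -
  have n: "CARD('l) = 2" unfolding two(1) using two(2) by simp
  have cases: "b = z \<or> b = z'" for b using two(1) by auto
  have "of_bool (b = b') - 1 / real CARD('l) = 1 / 2 * (symbol_sign z b * symbol_sign z b')" for b b'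
    using cases[of b] cases[of b'] two(2) by (auto simp: n symbol_sign_def)
  then have "J_kernel u i i' = (\<Prod>j\<in>UNIV. 1 / 2 *
      (if j \<in> u then symbol_sign z (i $ j) * symbol_sign z (i' $ j) else 1))"
    unfolding J_kernel_def by (intro prod.cong refl) (simp add: n)
  also have "\<dots> = (1 / 2) ^ CARD('k) * (\<Prod>j\<in>u. symbol_sign z (i $ j) * symbol_sign z (i' $ j))"
    by (simp only: prod.distrib prod_constant) (simp add: prod.If_cases prod.distrib)
  also have "(\<Prod>j\<in>u. symbol_sign z (i $ j) * symbol_sign z (i' $ j)) =
      (\<Prod>j\<in>u. symbol_sign z (i $ j)) * (\<Prod>j\<in>u. symbol_sign z (i' $ j))"
    by (rule prod.distrib)
  finally show ?thesis by (simp only: mult.assoc)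
qed

text \<open>
  Complementing a row outside \<open>m\<close> changes the character at \<open>u\<close> by one sign for each element of
  \<open>u - {m}\<close>.
\<close>

lemma prod_symbol_sign_foldover_swap:
  fixes i :: "'l::finite ^ 'k::finite"
  assumes two: "UNIV = {z, z' :: 'l}" "z \<noteq> z'"
  shows "(\<Prod>j\<in>u. symbol_sign z (foldover_swap z z' m i $ j)) =
    (\<Prod>j\<in>toggle_odd m u. symbol_sign z (i $ j))"
proof -
  have cases: "b = z \<or> b = z'" for b using two(1) by auto
  let ?\<epsilon> = "symbol_sign z (i $ m)"
  have sq: "?\<epsilon> * ?\<epsilon> = 1" by (simp add: symbol_sign_def)
  have "symbol_sign z (foldover_swap z z' m i $ j) =
      symbol_sign z (i $ j) * (if j \<in> - {m} then ?\<epsilon> else 1)" for j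
    using cases[of "i $ j"] cases[of "i $ m"] two(2)
    by (auto simp: symbol_sign_def foldover_swap_def)
  then have "(\<Prod>j\<in>u. symbol_sign z (foldover_swap z z' m i $ j)) =
      (\<Prod>j\<in>u. symbol_sign z (i $ j)) * (\<Prod>j\<in>u. if j \<in> - {m} then ?\<epsilon> else 1)"
    by (simp only: prod.distrib)
  also have "(\<Prod>j\<in>u. if j \<in> - {m} then ?\<epsilon> else 1) = ?\<epsilon> ^ card (u - {m})"
  proof -
    have "(\<Prod>j\<in>u. if j \<in> - {m} then ?\<epsilon> else 1) = (\<Prod>j\<in>u - {m}. ?\<epsilon>)"
      by (rule prod.mono_neutral_cong_right) auto
    then show ?thesis by simp
  qed
  also have "\<dots> = (if even (card (u - {m})) then 1 else ?\<epsilon>)"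
    by (auto simp: power_mult power2_eq_square sq elim!: evenE oddE)
  also have "(\<Prod>j\<in>u. symbol_sign z (i $ j)) * \<dots> = (\<Prod>j\<in>toggle_odd m u. symbol_sign z (i $ j))"
  proof (cases "m \<in> u")
    case True
    have "(\<Prod>j\<in>u. symbol_sign z (i $ j)) = ?\<epsilon> * (\<Prod>j\<in>u - {m}. symbol_sign z (i $ j))"
      using True by (rule prod.remove[OF finite])
    then show ?thesis using True sq by (simp add: toggle_odd_def mult_ac)
  next
    case False
    then show ?thesis by (simp add: toggle_odd_def mult.commute)
  qed
  finally show ?thesis .
qed

lemma bij_foldover_swap:
  fixes z :: "'l::finite" and m :: "'k::finite"
  shows "bij (foldover_swap z z' m :: 'l ^ 'k \<Rightarrow> 'l ^ 'k)"
  by (rule o_bij[of "foldover_swap z z' m"]) (auto simp: foldover_swap_def vec_eq_iff fun_eq_iff)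

lemma foldover_swap_involutory:
  "foldover_swap z z' m (foldover_swap z z' m i) = i"
  by (auto simp: foldover_swap_def vec_eq_iff)

lemma J_kernel_foldover_swap:
  fixes i i' :: "'l::finite ^ 'k::finite"
  assumes two: "UNIV = {z, z' :: 'l}" "z \<noteq> z'"
  shows "J_kernel (toggle_odd m u) (foldover_swap z z' m i) (foldover_swap z z' m i') = J_kernel u i i'"
  unfolding J_kernel_two_symbols[OF two] prod_symbol_sign_foldover_swap[OF two, symmetric]
    foldover_swap_involutory ..

lemma toggle_odd_insert: "finite u \<Longrightarrow> m \<notin> u \<Longrightarrow> odd (card u) \<Longrightarrow> toggle_odd m u = insert m u"
  by (simp add: toggle_odd_def)

lemma toggle_odd_remove: "finite u \<Longrightarrow> m \<in> u \<Longrightarrow> even (card u) \<Longrightarrow> toggle_odd m u = u - {m}"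
  by (auto simp: toggle_odd_def card_gt_0_iff)

text \<open>
  Here the parity of \<open>s\<close> enters: only odd sets grow, and an odd set of size at most \<open>s\<close> has size less
  than \<open>s\<close>.
\<close>

lemma foldover_swap_OA_frequency_vectors:
  fixes x :: "real ^ ('l::finite ^ 'k::finite)"
  assumes two: "UNIV = {z, z' :: 'l}" "z \<noteq> z'"
    and s: "s \<le> CARD('k)" "even s" and x: "x \<in> OA_frequency_vectors lam s"
  shows "(\<chi> i. x $ foldover_swap z z' m i) \<in> OA_frequency_vectors lam s"
proof (rule OA_frequency_vectors_reindex[where h = "toggle_odd m" and g = "foldover_swap z z' m"])
  show "1 \<le> card (toggle_odd m u) \<and> card (toggle_odd m u) \<le> s" if u: "1 \<le> card u" "card u \<le> s"
    for u :: "'k set"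
  proof -
    consider "toggle_odd m u = u" | "m \<in> u" "odd (card (u - {m}))" | "m \<notin> u" "odd (card u)"
      unfolding toggle_odd_def by (metis Diff_empty Diff_insert0)
    then show ?thesis
    proof cases
      case 2
      have "toggle_odd m u = u - {m}" unfolding toggle_odd_def using 2 by simp
      moreover have "card (u - {m}) > 0" using 2(2) by (rule odd_pos)
      moreover have "card (u - {m}) \<le> card u" by (rule card_Diff1_le)
      ultimately show ?thesis using u by simp
    next
      case 3
      then have "card u \<noteq> s" using s(2) by auto
      then show ?thesis using 3 u by (simp add: toggle_odd_insert)
    qed (use u in simp)
  qed
  show "J_kernel (toggle_odd m u) (foldover_swap z z' m i) (foldover_swap z z' m i') = J_kernel u i i'"
    for u and i i' :: "'l ^ 'k"
    by (rule J_kernel_foldover_swap[OF two])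
qed (simp_all add: s x bij_foldover_swap toggle_odd_def)

lemma J_part_eq_0_of_toggle_odd:
  fixes x :: "real ^ ('l::finite ^ 'k::finite)"
  assumes n: "CARD('l) = 2" and s: "s \<le> CARD('k)" "even s" and x: "x \<in> OA_frequency_vectors lam s"
    and zero: "\<And>(y :: real ^ ('l ^ 'k)) i. y \<in> OA_frequency_vectors lam s \<Longrightarrow> J_part y (toggle_odd m u) i = 0"
  shows "J_part x u i = 0"
proof -
  obtain z z' where two: "UNIV = {z, z' :: 'l}" "z \<noteq> z'"
    using n by (auto simp: card_2_iff)
  let ?f = "foldover_swap z z' m"
  let ?y = "\<chi> i. x $ ?f i"
  have y: "?y \<in> OA_frequency_vectors lam s"
    by (rule foldover_swap_OA_frequency_vectors[OF two s x])
  have "J_part (\<chi> i. ?y $ ?f i) u i = J_part ?y (toggle_odd m u) (?f i)"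
    by (rule J_part_reindex[OF bij_foldover_swap J_kernel_foldover_swap[OF two]])
  also have "(\<chi> i. ?y $ ?f i) = x"
    by (simp add: foldover_swap_involutory vec_eq_iff)
  finally show ?thesis using zero[OF y] by simp
qed

text \<open>
  With a suitable column \<open>m\<close>, inside the larger or outside the smaller set, the exchange takes
  components of size \<open>d\<close> to components of size \<open>d - 1\<close> and conversely.
\<close>

lemma vanishing_degrees_pair:
  fixes S :: "(real ^ ('l::finite ^ 'k::finite)) set"
  assumes n: "CARD('l) = 2" and s: "s \<le> CARD('k)" "even s"
    and S: "S = OA_frequency_vectors lam s" and d: "even d" "s + 2 \<le> d" "d \<le> CARD('k)"
  shows "d \<in> vanishing_degrees s S \<longleftrightarrow> d - 1 \<in> vanishing_degrees s S"
proof
  assume z: "d \<in> vanishing_degrees s S"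
  have "J_part x u i = 0" if x: "x \<in> S" and u: "card u = d - 1" for x u i
  proof -
    have "u \<noteq> UNIV" using u d by auto
    then obtain m where m: "m \<notin> u" by blast
    have "toggle_odd m u = insert m u"
      using m u d by (intro toggle_odd_insert) auto
    then have "card (toggle_odd m u) = d" using m u d by simp
    then have "J_part y (toggle_odd m u) i' = 0" if "y \<in> S" for y i'
      using z that unfolding vanishing_degrees_def by blast
    then show ?thesis
      using x unfolding S by (rule J_part_eq_0_of_toggle_odd[OF n s, rotated])
  qed
  then show "d - 1 \<in> vanishing_degrees s S"
    using d by (auto simp: vanishing_degrees_def)
next
  assume z: "d - 1 \<in> vanishing_degrees s S"
  have "J_part x u i = 0" if x: "x \<in> S" and u: "card u = d" for x u i
  proof -
    have "u \<noteq> {}" using u d by auto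
    then obtain m where m: "m \<in> u" by blast
    have "toggle_odd m u = u - {m}"
      using m u d by (intro toggle_odd_remove) auto
    then have "card (toggle_odd m u) = d - 1" using m u by simp
    then have "J_part y (toggle_odd m u) i' = 0" if "y \<in> S" for y i'
      using z that unfolding vanishing_degrees_def by blast
    then show ?thesis
      using x unfolding S by (rule J_part_eq_0_of_toggle_odd[OF n s, rotated])
  qed
  then show "d \<in> vanishing_degrees s S"
    using d by (auto simp: vanishing_degrees_def)
qed

section \<open>Constraints for the affine hull\<close>

theorem corollary3:
  fixes lam n k s :: nat
    and S :: "(real ^ ('l::finite ^ 'k::finite)) set"
  assumes "n = CARD('l)" and "k = CARD('k)"
    and "lam \<ge> 1" and "n \<ge> 2" and "k \<ge> 1" and "1 \<le> s" and "s \<le> k"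
    and "\<exists>A :: ('l ^ 'k) list. orthogonal_array lam s A"
    and "S = OA_frequency_vectors lam s"
  shows "(n = 2 \<and> even s \<longrightarrow>
            (\<exists>T T'. T \<subseteq> Omega1 lam s k \<and> T' \<subseteq> Omega1' k \<and>
               affine hull S =
                 {x. OA_equalities lam s x \<and>
                     (\<forall>u. card u \<in> T \<union> (\<lambda>d. d - 1) ` T \<longrightarrow> (\<forall>i. J_char x u i = 0)) \<and>
                     (card T' = 1 \<longrightarrow> (\<forall>i. J_char x UNIV i = 0))}))
       \<and> (n \<ge> 3 \<or> odd s \<longrightarrow>
            (\<exists>T. T \<subseteq> Omega2 lam n s k \<and>
               affine hull S =
                 {x. OA_equalities lam s x \<and>
                     (\<forall>u. card u \<in> T \<longrightarrow> (\<forall>i. J_char x u i = 0))}))"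
proof -
  note S = assms(9)
  have s: "s \<le> CARD('k)" using assms(2,7) by simp
  have ne: "S \<noteq> {}" using assms(8) by (auto simp: S OA_frequency_vectors_def)
  let ?Z = "vanishing_degrees s S"
  have hull: "affine hull S =
      {x. OA_equalities lam s x \<and> (\<forall>u. card u \<in> ?Z \<longrightarrow> (\<forall>i. J_char x u i = 0))}"
    by (rule affine_hull_OA_frequency_vectors[OF s S ne])
  have Z: "s + 1 \<le> d \<and> d \<le> k" if "d \<in> ?Z" for d
    using that assms(2) by (simp add: vanishing_degrees_def)
  have dvd: "n dvd lam * ((d - 1) choose (d - 1 - s))" if "d \<in> ?Z" for d
    using vanishing_degrees_dvd[OF s S ne that] assms(1) by simp
  have "\<exists>T T'. T \<subseteq> Omega1 lam s k \<and> T' \<subseteq> Omega1' k \<and>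
      affine hull S =
        {x. OA_equalities lam s x \<and>
            (\<forall>u. card u \<in> T \<union> (\<lambda>d. d - 1) ` T \<longrightarrow> (\<forall>i. J_char x u i = 0)) \<and>
            (card T' = 1 \<longrightarrow> (\<forall>i. J_char x UNIV i = 0))}"
    if n: "n = 2" and even: "even s"
  proof -
    \<comment> \<open>An even size stands for the pair that it forms with its predecessor. Only an odd \<open>k\<close> has no partner.\<close>
    define T where "T = {d \<in> ?Z. even d}"
    define T' where "T' = {d \<in> ?Z. odd d \<and> d = k}"
    have T_ge: "s + 2 \<le> d" if "d \<in> T" for d
    proof -
      have "s + 1 \<le> d" "d \<noteq> s + 1" using that Z even by (auto simp: T_def)
      then show ?thesis by simp
    qed
    have pair: "d \<in> ?Z \<longleftrightarrow> d - 1 \<in> ?Z" if "even d" "s + 2 \<le> d" "d \<le> k" for d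
      using vanishing_degrees_pair[of s S lam d] n s even S that assms(1,2) by simp
    have T: "T \<subseteq> Omega1 lam s k"
    proof
      fix d assume d: "d \<in> T"
      have "2 dvd lam * ((d - 1) choose (d - s - 1))"
        using dvd[of d] d n by (simp add: T_def diff_commute)
      then show "d \<in> Omega1 lam s k"
        using d T_ge Z by (auto simp: Omega1_def T_def cong_0_iff)
    qed
    have T': "T' \<subseteq> Omega1' k"
      by (auto simp: T'_def Omega1'_def)
    have cover: "?Z = T \<union> (\<lambda>d. d - 1) ` T \<union> T'"
    proof
      show "?Z \<subseteq> T \<union> (\<lambda>d. d - 1) ` T \<union> T'"
      proof
        fix d assume d: "d \<in> ?Z"
        consider "even d" | "odd d" "d = k" | "odd d" "d + 1 \<le> k"
          using Z[OF d] by linarith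
        then show "d \<in> T \<union> (\<lambda>d. d - 1) ` T \<union> T'"
        proof cases
          case 3
          then have "d + 1 \<in> T"
            using pair[of "d + 1"] d Z[OF d] by (simp add: T_def)
          then have "d + 1 - 1 \<in> (\<lambda>d. d - 1) ` T" by (rule imageI)
          then show ?thesis by simp
        qed (use d in \<open>auto simp: T_def T'_def\<close>)
      qed
      show "T \<union> (\<lambda>d. d - 1) ` T \<union> T' \<subseteq> ?Z"
        using pair T_ge Z by (auto simp: T_def T'_def)
    qed
    have top: "(\<forall>u. card u \<in> T' \<longrightarrow> (\<forall>i. J_char x u i = 0)) \<longleftrightarrow>
        (card T' = 1 \<longrightarrow> (\<forall>i. J_char x UNIV i = 0))" for x :: "real ^ ('l ^ 'k)"
    proof (cases "k \<in> ?Z \<and> odd k")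
      case True
      then have "T' = {k}" by (auto simp: T'_def)
      moreover have "card u = k \<longleftrightarrow> u = UNIV" for u :: "'k set"
        using assms(2) card_subset_eq[of UNIV u] by auto
      ultimately show ?thesis by simp
    next
      case False
      then have "T' = {}" by (auto simp: T'_def)
      then show ?thesis by simp
    qed
    have "(\<forall>u. card u \<in> ?Z \<longrightarrow> (\<forall>i. J_char x u i = 0)) \<longleftrightarrow>
        (\<forall>u. card u \<in> T \<union> (\<lambda>d. d - 1) ` T \<longrightarrow> (\<forall>i. J_char x u i = 0)) \<and>
        (\<forall>u. card u \<in> T' \<longrightarrow> (\<forall>i. J_char x u i = 0))" for x :: "real ^ ('l ^ 'k)"
      unfolding cover Un_iff by blast
    then have "affine hull S =
        {x. OA_equalities lam s x \<and>
            (\<forall>u. card u \<in> T \<union> (\<lambda>d. d - 1) ` T \<longrightarrow> (\<forall>i. J_char x u i = 0)) \<and>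
            (card T' = 1 \<longrightarrow> (\<forall>i. J_char x UNIV i = 0))}"
      unfolding hull top by simp
    with T T' show ?thesis by (intro exI[of _ T] exI[of _ T'] conjI)
  qed
  moreover have "?Z \<subseteq> Omega2 lam n s k"
    using Z dvd by (auto simp: Omega2_def cong_0_iff)
  ultimately show ?thesis using hull by blast
qed

end
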